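(* Let $\Gamma$ be a directed graph, $I(\Gamma)$ its graph inverse semigroup, and $pq^*$, $xy^*$ non-zero elements of $I(\Gamma)$, where $p,q,x,y$ are directed paths in $\Gamma$ with $r(p)=r(q)$ and $r(x)=r(y)$. Then: (1) $pq^*\,\mathscr{L}\,xy^*$ if and only if $q=y$; (2) $pq^*\,\mathscr{R}\,xy^*$ if and only if $p=x$; (3) $pq^*\,\mathscr{D}\,xy^*$ if and only if $r(p)=r(x)$; (4) $pq^*\,\mathscr{J}\,xy^*$ if and only if $r(p)$ and $r(x)$ are in the same strongly connected component of $\Gamma$; (5) $pq^*\,\mathscr{H}\,xy^*$ if and only if $pq^*=xy^*$.
   Context: A directed graph $\Gamma$ consists of a non-empty set $\Gamma^0$ of vertices, a possibly empty set $\Gamma^1$ of edges, and source and range maps $s,r:\Gamma^1\to\Gamma^0$. A directed path is either a vertex $v$ (trivial path, $s(v)=r(v)=v$) or a finite sequence $p=e_1e_2\cdots e_n$ of edges with $r(e_i)=s(e_{i+1})$ for $1\le i\le n-1$; then $s(p)=s(e_1)$ and $r(p)=r(e_n)$. For each edge $e$ there is an inverse (ghost) edge $e^*$ with $s(e^* )=r(e)$, $r(e^* )=s(e)$; $(\Gamma^1)^*$ is the set of ghost edges. For a path $p=e_1\cdots e_n$, $p^*=e_n^*\cdots e_1^*$, and $v^*=v$ for a vertex $v$. Two vertices $u,v$ are strongly connected if there are directed paths from $u$ to $v$ and from $v$ to $u$; this is an equivalence relation on $\Gamma^0$ whose classes are the strongly connected components. The graph inverse semigroup $I(\Gamma)$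 is the semigroup with zero $0$ generated by $\Gamma^0\cup\Gamma^1\cup(\Gamma^1)^*$ subject to the relations: (1) $s(e)e=e=e\,r(e)$ for all $e\in\Gamma^0\cup\Gamma^1\cup(\Gamma^1)^*$; (2) $uv=u$ if $u=v$ and $uv=0$ if $u\neq v$, for all $u,v\in\Gamma^0$; (3) $e^*f=r(e)$ if $e=f$ and $e^*f=0$ if $e\ne f$, for all $e,f\in\Gamma^1$. The zero element is always included in $I(\Gamma)$. The non-zero elements of $I(\Gamma)$ are exactly the products $pq^*$ with $p,q$ directed paths and $r(p)=r(q)$, and $p,q$ are uniquely determined by $pq^*$. Green's relations on a semigroup $S$ (with $S^1$ denoting $S$ with an identity adjoined if necessary): $a\,\mathscr{L}\,b$ iff $S^1a=S^1b$; $a\,\mathscr{R}\,b$ iff $aS^1=bS^1$; $a\,\mathscr{J}\,b$ iff $S^1aS^1=S^1bS^1$; $\mathscr{D}=\mathscr{L}\circ\mathscr{R}=\mathscr{R}\circ\mathscr{L}$; $\mathscr{H}=\mathscr{L}\cap\mathscr{R}$. *)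

theory Defs
  imports "Graph_Theory.Digraph" "Graph_Theory.Arc_Walk"
begin

section \<open>Semigroups, Green's relations and presentations\<close>

record 'a sgrp =
  elts :: "'a set"
  prd :: "'a \<Rightarrow> 'a \<Rightarrow> 'a"

definition has_identity :: "'a sgrp \<Rightarrow> bool" where
  "has_identity S \<longleftrightarrow> (\<exists>e \<in> elts S. \<forall>a \<in> elts S. prd S e a = a \<and> prd S a e = a)"

text \<open>The semigroup \<open>S\<^sup>1\<close>: an element \<open>a\<close> of \<open>S\<close> is represented by \<open>Some a\<close>, and \<open>None\<close> is the
  adjoined identity, which belongs to \<open>S\<^sup>1\<close> only if \<open>S\<close> has no identity of its own.\<close>

fun prd1 :: "('a \<Rightarrow> 'a \<Rightarrow> 'a) \<Rightarrow> 'a option \<Rightarrow> 'a option \<Rightarrow> 'a option" where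
  "prd1 m None b = b"
| "prd1 m a None = a"
| "prd1 m (Some a) (Some b) = Some (m a b)"

definition adjoin_identity :: "'a sgrp \<Rightarrow> 'a option sgrp" where
  "adjoin_identity S =
     \<lparr> elts = (if has_identity S then Some ` elts S else insert None (Some ` elts S)),
       prd = prd1 (prd S) \<rparr>"

definition left_ideal :: "'a sgrp \<Rightarrow> 'a \<Rightarrow> 'a option set" where
  "left_ideal S a = (let T = adjoin_identity S in {prd T s (Some a) | s. s \<in> elts T})"

definition right_ideal :: "'a sgrp \<Rightarrow> 'a \<Rightarrow> 'a option set" where
  "right_ideal S a = (let T = adjoin_identity S in {prd T (Some a) t | t. t \<in> elts T})"

definition two_sided_ideal :: "'a sgrp \<Rightarrow> 'a \<Rightarrow> 'a option set" where
  "two_sided_ideal S a =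
     (let T = adjoin_identity S in {prd T (prd T s (Some a)) t | s t. s \<in> elts T \<and> t \<in> elts T})"

definition green_L :: "'a sgrp \<Rightarrow> 'a rel" where
  "green_L S = {(a, b). a \<in> elts S \<and> b \<in> elts S \<and> left_ideal S a = left_ideal S b}"

definition green_R :: "'a sgrp \<Rightarrow> 'a rel" where
  "green_R S = {(a, b). a \<in> elts S \<and> b \<in> elts S \<and> right_ideal S a = right_ideal S b}"

definition green_J :: "'a sgrp \<Rightarrow> 'a rel" where
  "green_J S = {(a, b). a \<in> elts S \<and> b \<in> elts S \<and> two_sided_ideal S a = two_sided_ideal S b}"

definition green_D :: "'a sgrp \<Rightarrow> 'a rel" where
  "green_D S = green_L S O green_R S"

definition green_H :: "'a sgrp \<Rightarrow> 'a rel" where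
  "green_H S = green_L S \<inter> green_R S"

inductive_set congruence_gen :: "'a sgrp \<Rightarrow> 'a rel \<Rightarrow> 'a rel"
  for S :: "'a sgrp" and R :: "'a rel" where
  base: "(a, b) \<in> R \<Longrightarrow> a \<in> elts S \<Longrightarrow> b \<in> elts S \<Longrightarrow> (a, b) \<in> congruence_gen S R"
| refl: "a \<in> elts S \<Longrightarrow> (a, a) \<in> congruence_gen S R"
| sym: "(a, b) \<in> congruence_gen S R \<Longrightarrow> (b, a) \<in> congruence_gen S R"
| trans: "(a, b) \<in> congruence_gen S R \<Longrightarrow> (b, c) \<in> congruence_gen S R
    \<Longrightarrow> (a, c) \<in> congruence_gen S R"
| left: "(a, b) \<in> congruence_gen S R \<Longrightarrow> c \<in> elts S
    \<Longrightarrow> (prd S c a, prd S c b) \<in> congruence_gen S R"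
| right: "(a, b) \<in> congruence_gen S R \<Longrightarrow> c \<in> elts S
    \<Longrightarrow> (prd S a c, prd S b c) \<in> congruence_gen S R"

definition quotient_sgrp :: "'a sgrp \<Rightarrow> 'a rel \<Rightarrow> 'a set sgrp" where
  "quotient_sgrp S C =
     \<lparr> elts = elts S // C, prd = (\<lambda>A B. \<Union>a \<in> A. \<Union>b \<in> B. C `` {prd S a b}) \<rparr>"

text \<open>The free semigroup with zero on \<open>X\<close>: \<open>Some w\<close> is a non-empty word, \<open>None\<close> is the zero.\<close>

fun word_prd :: "'g list option \<Rightarrow> 'g list option \<Rightarrow> 'g list option" where
  "word_prd (Some v) (Some w) = Some (v @ w)"
| "word_prd _ _ = None"

definition free_sgrp_with_zero :: "'g set \<Rightarrow> 'g list option sgrp" where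
  "free_sgrp_with_zero X =
     \<lparr> elts = insert None (Some ` {w. w \<noteq> [] \<and> set w \<subseteq> X}), prd = word_prd \<rparr>"


section \<open>The graph inverse semigroup\<close>

datatype ('v, 'e) gen = Vert 'v | Edge 'e | Ghost 'e

definition gens :: "('v, 'e) pre_digraph \<Rightarrow> ('v, 'e) gen set" where
  "gens G = Vert ` verts G \<union> Edge ` arcs G \<union> Ghost ` arcs G"

fun gen_source :: "('v, 'e) pre_digraph \<Rightarrow> ('v, 'e) gen \<Rightarrow> 'v" where
  "gen_source G (Vert v) = v"
| "gen_source G (Edge e) = tail G e"
| "gen_source G (Ghost e) = head G e"

fun gen_range :: "('v, 'e) pre_digraph \<Rightarrow> ('v, 'e) gen \<Rightarrow> 'v" where
  "gen_range G (Vert v) = v"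
| "gen_range G (Edge e) = head G e"
| "gen_range G (Ghost e) = tail G e"

inductive_set gis_relations :: "('v, 'e) pre_digraph \<Rightarrow> ('v, 'e) gen list option rel"
  for G :: "('v, 'e) pre_digraph" where
  source: "x \<in> gens G \<Longrightarrow> (Some [Vert (gen_source G x), x], Some [x]) \<in> gis_relations G"
| range: "x \<in> gens G \<Longrightarrow> (Some [x, Vert (gen_range G x)], Some [x]) \<in> gis_relations G"
| vert_eq: "u \<in> verts G \<Longrightarrow> (Some [Vert u, Vert u], Some [Vert u]) \<in> gis_relations G"
| vert_neq: "u \<in> verts G \<Longrightarrow> v \<in> verts G \<Longrightarrow> u \<noteq> v
    \<Longrightarrow> (Some [Vert u, Vert v], None) \<in> gis_relations G"
| ghost_eq: "e \<in> arcs G \<Longrightarrow> (Some [Ghost e, Edge e], Some [Vert (head G e)]) \<in> gis_relations G"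
| ghost_neq: "e \<in> arcs G \<Longrightarrow> f \<in> arcs G \<Longrightarrow> e \<noteq> f
    \<Longrightarrow> (Some [Ghost e, Edge f], None) \<in> gis_relations G"

definition gis_cong :: "('v, 'e) pre_digraph \<Rightarrow> ('v, 'e) gen list option rel" where
  "gis_cong G = congruence_gen (free_sgrp_with_zero (gens G)) (gis_relations G)"

definition gis :: "('v, 'e) pre_digraph \<Rightarrow> ('v, 'e) gen list option set sgrp" where
  "gis G = quotient_sgrp (free_sgrp_with_zero (gens G)) (gis_cong G)"

text \<open>A directed path is a pair of its source and its list of edges; \<open>(v, [])\<close> is the trivial
  path at \<open>v\<close>.  For a non-empty list the source is forced to be the tail of the first edge.\<close>

type_synonym ('v, 'e) dpath = "'v \<times> 'e list"

definition directed_path :: "('v, 'e) pre_digraph \<Rightarrow> ('v, 'e) dpath \<Rightarrow> bool" where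
  "directed_path G p \<longleftrightarrow> (\<exists>v. pre_digraph.awalk G (fst p) (snd p) v)"

definition path_range :: "('v, 'e) pre_digraph \<Rightarrow> ('v, 'e) dpath \<Rightarrow> 'v" where
  "path_range G p = pre_digraph.awlast G (fst p) (snd p)"

fun path_word :: "('v, 'e) dpath \<Rightarrow> ('v, 'e) gen list" where
  "path_word (u, []) = [Vert u]"
| "path_word (u, e # es) = map Edge (e # es)"

fun path_star_word :: "('v, 'e) dpath \<Rightarrow> ('v, 'e) gen list" where
  "path_star_word (u, []) = [Vert u]"
| "path_star_word (u, e # es) = map Ghost (rev (e # es))"

definition gis_class ::
  "('v, 'e) pre_digraph \<Rightarrow> ('v, 'e) gen list \<Rightarrow> ('v, 'e) gen list option set" where
  "gis_class G w = gis_cong G `` {Some w}"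

text \<open>The element \<open>pq\<^sup>*\<close> of the graph inverse semigroup.\<close>

definition gis_elem ::
  "('v, 'e) pre_digraph \<Rightarrow> ('v, 'e) dpath \<Rightarrow> ('v, 'e) dpath \<Rightarrow> ('v, 'e) gen list option set" where
  "gis_elem G p q = prd (gis G) (gis_class G (path_word p)) (gis_class G (path_star_word q))"

definition strong_connection :: "('v, 'e) pre_digraph \<Rightarrow> 'v rel" where
  "strong_connection G = {(u, v). u \<in> verts G \<and> v \<in> verts G \<and>
     (\<exists>p. pre_digraph.awalk G u p v) \<and> (\<exists>p. pre_digraph.awalk G v p u)}"

definition strong_components :: "('v, 'e) pre_digraph \<Rightarrow> 'v set set" where
  "strong_components G = verts G // strong_connection G"

end

theory Submission
  imports Defs
begin

text \<open>
  An element \<open>pq\<^sup>*\<close> determines the partial map \<open>qz \<mapsto> pz\<close> that replaces the prefix \<open>q\<close> of a path by \<open>p\<close>.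
  Everything that distinguishes elements is read off this representation.  Its domain is the set of
  extensions of \<open>q\<close> and its range the set of extensions of \<open>p\<close>, and a set of extensions determines
  the path at its root.  Since \<open>SA\<close> has its domain inside that of \<open>A\<close>, and \<open>AT\<close> its range inside that
  of \<open>A\<close>, being L-related forces equal domains (\<open>green_L_dom\<close>) and being R-related equal ranges
  (\<open>green_R_ran\<close>).

  The map of any element, not only of one already written as \<open>pq\<^sup>*\<close>, keeps the range vertex of a
  path (\<open>class_act_awalk\<close>) and commutes with appending edges (\<open>class_act_append_path\<close>); so no normal
  form is needed for the unknown elements that occur in the definitions of D and J.  For D, an
  intermediate element \<open>C\<close> has the domain of \<open>pq\<^sup>*\<close> and the range of \<open>xy\<^sup>*\<close>.  Commuting with appending
  makes it send \<open>q\<close> to \<open>x\<close> exactly, whence \<open>r(q) = r(x)\<close>.  For J, if \<open>pq\<^sup>* = S xy\<^sup>* T\<close> then \<open>T\<close> must send \<open>q\<close>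
  to some \<open>yz\<close>, and \<open>z\<close> is a walk from \<open>r(y)\<close> to \<open>r(q)\<close>.

  The converse directions all come from one product in the semigroup,
  \<open>a(pz)\<^sup>* \<cdot> pq\<^sup>* = a(qz)\<^sup>*\<close> (\<open>gis_elem_mult\<close>), which is computed from the defining relations.
  For L and R it is used with \<open>z\<close> trivial; D passes through \<open>xq\<^sup>*\<close>; for J the path \<open>z\<close> is the
  one that strong connectedness supplies.
\<close>

section \<open>Principal ideals and Green's relations\<close>

locale semigroup_record =
  fixes S :: "'a sgrp"
  assumes prd_closed: "a \<in> elts S \<Longrightarrow> b \<in> elts S \<Longrightarrow> prd S a b \<in> elts S"
    and prd_assoc: "a \<in> elts S \<Longrightarrow> b \<in> elts S \<Longrightarrow> c \<in> elts S
      \<Longrightarrow> prd S (prd S a b) c = prd S a (prd S b c)"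
begin

lemma left_ideal_eq:
  assumes "a \<in> elts S"
  shows "left_ideal S a = Some ` insert a {prd S s a | s. s \<in> elts S}"
proof (cases "has_identity S")
  case True
  then obtain e where "e \<in> elts S" "prd S e a = a"
    using assms unfolding has_identity_def by blast
  then show ?thesis
    using True unfolding left_ideal_def adjoin_identity_def Let_def
    by (auto simp: image_iff) force+
next
  case False
  then show ?thesis
    unfolding left_ideal_def adjoin_identity_def Let_def
    by (auto simp: image_iff) (metis prd1.simps(1,3))+
qed

lemma right_ideal_eq:
  assumes "a \<in> elts S"
  shows "right_ideal S a = Some ` insert a {prd S a t | t. t \<in> elts S}"
proof (cases "has_identity S")
  case True
  then obtain e where "e \<in> elts S" "prd S a e = a"
    using assms unfolding has_identity_def by blast
  then show ?thesis
    using True unfolding right_ideal_def adjoin_identity_def Let_def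
    by (auto simp: image_iff) force+
next
  case False
  then show ?thesis
    unfolding right_ideal_def adjoin_identity_def Let_def
    by (auto simp: image_iff) (metis prd1.simps(2,3))+
qed

lemma two_sided_ideal_eq:
  assumes "a \<in> elts S"
  shows "two_sided_ideal S a = (\<Union>b\<in>{b. Some b \<in> left_ideal S a}. right_ideal S b)"
proof -
  let ?T = "adjoin_identity S"
  have some: "prd ?T s (Some a) \<in> range Some" for s
    by (cases s) (auto simp: adjoin_identity_def)
  show ?thesis
  proof (intro set_eqI iffI)
    fix z assume "z \<in> two_sided_ideal S a"
    then obtain s t where st: "s \<in> elts ?T" "t \<in> elts ?T" "z = prd ?T (prd ?T s (Some a)) t"
      unfolding two_sided_ideal_def Let_def by blast
    moreover obtain b where b: "prd ?T s (Some a) = Some b" using some by blast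
    ultimately have "Some b \<in> left_ideal S a" "z \<in> right_ideal S b"
      unfolding left_ideal_def right_ideal_def Let_def by (force, force)
    then show "z \<in> (\<Union>b\<in>{b. Some b \<in> left_ideal S a}. right_ideal S b)" by blast
  next
    fix z assume "z \<in> (\<Union>b\<in>{b. Some b \<in> left_ideal S a}. right_ideal S b)"
    then obtain b where "Some b \<in> left_ideal S a" "z \<in> right_ideal S b" by blast
    then obtain s t where "s \<in> elts ?T" "t \<in> elts ?T" "Some b = prd ?T s (Some a)"
        "z = prd ?T (Some b) t"
      unfolding left_ideal_def right_ideal_def Let_def by blast
    then show "z \<in> two_sided_ideal S a"
      unfolding two_sided_ideal_def Let_def by auto
  qed
qed

text \<open>The next two characterisations are independent of whether \<open>S\<close> has an identity: the element
  itself always lies in the ideals it generates.\<close>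

lemma green_L_iff:
  "(a, b) \<in> green_L S \<longleftrightarrow> a \<in> elts S \<and> b \<in> elts S \<and>
    (a = b \<or> (\<exists>s\<in>elts S. a = prd S s b)) \<and> (b = a \<or> (\<exists>s\<in>elts S. b = prd S s a))"
proof -
  have sub: "left_ideal S a \<subseteq> left_ideal S b \<longleftrightarrow> a = b \<or> (\<exists>s\<in>elts S. a = prd S s b)"
    if "a \<in> elts S" "b \<in> elts S" for a b
    using that prd_closed prd_assoc
    by (auto simp: left_ideal_eq image_iff) (metis+)
  show ?thesis
    unfolding green_L_def using sub[of a b] sub[of b a] by auto
qed

lemma green_R_iff:
  "(a, b) \<in> green_R S \<longleftrightarrow> a \<in> elts S \<and> b \<in> elts S \<and>
    (a = b \<or> (\<exists>t\<in>elts S. a = prd S b t)) \<and> (b = a \<or> (\<exists>t\<in>elts S. b = prd S a t))"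
proof -
  have sub: "right_ideal S a \<subseteq> right_ideal S b \<longleftrightarrow> a = b \<or> (\<exists>t\<in>elts S. a = prd S b t)"
    if "a \<in> elts S" "b \<in> elts S" for a b
    using that prd_closed prd_assoc
    by (auto simp: right_ideal_eq image_iff) (metis+)
  show ?thesis
    unfolding green_R_def using sub[of a b] sub[of b a] by auto
qed

text \<open>The one-sided steps are kept apart, as factors of \<open>S\<^sup>1\<close> need not be elements of \<open>S\<close>.\<close>

lemma green_J_D:
  assumes "(a, b) \<in> green_J S"
  shows "\<exists>c. (c = b \<or> (\<exists>s\<in>elts S. c = prd S s b)) \<and> (a = c \<or> (\<exists>t\<in>elts S. a = prd S c t))"
proof -
  have ab: "a \<in> elts S" "b \<in> elts S" and "two_sided_ideal S a = two_sided_ideal S b"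
    using assms unfolding green_J_def by auto
  moreover have "Some a \<in> two_sided_ideal S a"
    using ab by (auto simp: two_sided_ideal_eq left_ideal_eq right_ideal_eq)
  ultimately obtain c where c: "Some c \<in> left_ideal S b" "Some a \<in> right_ideal S c"
    by (auto simp: two_sided_ideal_eq)
  then have "c \<in> elts S"
    using ab prd_closed by (auto simp: left_ideal_eq)
  then have "c = b \<or> (\<exists>s\<in>elts S. c = prd S s b)" "a = c \<or> (\<exists>t\<in>elts S. a = prd S c t)"
    using c ab(2) unfolding left_ideal_eq[OF ab(2)] right_ideal_eq[OF \<open>c \<in> elts S\<close>] by blast+
  then show ?thesis by (intro exI[of _ c] conjI)
qed

lemma green_J_I:
  assumes "a \<in> elts S" "b \<in> elts S"
    and "s \<in> elts S" "t \<in> elts S" "a = prd S (prd S s b) t"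
    and "s' \<in> elts S" "t' \<in> elts S" "b = prd S (prd S s' a) t'"
  shows "(a, b) \<in> green_J S"
proof -
  have sub: "two_sided_ideal S a \<subseteq> two_sided_ideal S b"
    if ab: "a \<in> elts S" "b \<in> elts S" and st: "s \<in> elts S" "t \<in> elts S"
      and a: "a = prd S (prd S s b) t" for a b s t
  proof
    fix z assume "z \<in> two_sided_ideal S a"
    then obtain c where c: "Some c \<in> left_ideal S a" and z: "z \<in> right_ideal S c"
      using ab(1) by (auto simp: two_sided_ideal_eq)
    have "\<exists>s1\<in>elts S. c = prd S (prd S s1 b) t"
    proof (cases "c = a")
      case False
      then obtain s0 where "s0 \<in> elts S" "c = prd S s0 a"
        using c ab(1) by (auto simp: left_ideal_eq)
      then have "c = prd S (prd S (prd S s0 s) b) t" "prd S s0 s \<in> elts S"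
        using ab st a by (simp_all add: prd_assoc prd_closed)
      then show ?thesis by blast
    qed (use st a in blast)
    then obtain s1 where s1: "s1 \<in> elts S" "c = prd S (prd S s1 b) t" by blast
    then have bc: "prd S s1 b \<in> elts S" "c \<in> elts S"
      using ab(2) st by (simp_all add: prd_closed)
    have "\<exists>t1\<in>elts S. z = Some (prd S (prd S s1 b) t1)"
    proof (cases "z = Some c")
      case False
      then obtain t0 where "t0 \<in> elts S" "z = Some (prd S c t0)"
        using z bc(2) by (auto simp: right_ideal_eq)
      then have "z = Some (prd S (prd S s1 b) (prd S t t0))" "prd S t t0 \<in> elts S"
        using st(2) s1(2) bc(1) by (simp_all add: prd_assoc prd_closed)
      then show ?thesis by blast
    qed (use s1 st in blast)
    then obtain t1 where t1: "t1 \<in> elts S" "z = Some (prd S (prd S s1 b) t1)" by blast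
    have "Some (prd S s1 b) \<in> left_ideal S b"
      using s1(1) unfolding left_ideal_eq[OF ab(2)] by blast
    moreover have "z \<in> right_ideal S (prd S s1 b)"
      using t1 unfolding right_ideal_eq[OF bc(1)] by blast
    ultimately show "z \<in> two_sided_ideal S b"
      unfolding two_sided_ideal_eq[OF ab(2)] by blast
  qed
  show ?thesis
    unfolding green_J_def
    using assms(1,2) sub[OF assms(1-5)] sub[OF assms(2,1,6-8)] by blast
qed

end

section \<open>Congruences and quotients\<close>

locale semigroup_congruence = semigroup_record S for S :: "'a sgrp" +
  fixes R :: "'a rel"
begin

abbreviation cong where "cong \<equiv> congruence_gen S R"

lemma congruence_gen_elts:
  assumes "(a, b) \<in> cong"
  shows "a \<in> elts S \<and> b \<in> elts S"
  using assms by induction (auto intro: prd_closed)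

lemma equiv_congruence_gen: "equiv (elts S) cong"
proof (rule equivI)
  show "cong \<subseteq> elts S \<times> elts S" using congruence_gen_elts by auto
  show "refl_on (elts S) cong" by (rule refl_onI) (rule congruence_gen.refl)
  show "sym cong" by (rule symI) (rule congruence_gen.sym)
  show "trans cong" by (rule transI) (rule congruence_gen.trans)
qed

lemma congruence_gen_prd:
  assumes "(a, a') \<in> cong" "(b, b') \<in> cong"
  shows "(prd S a b, prd S a' b') \<in> cong"
proof (rule congruence_gen.trans)
  show "(prd S a b, prd S a' b) \<in> cong"
    using assms congruence_gen_elts by (intro congruence_gen.right) auto
  show "(prd S a' b, prd S a' b') \<in> cong"
    using assms congruence_gen_elts by (intro congruence_gen.left) auto
qed

lemma elts_quotient: "elts (quotient_sgrp S cong) = {cong `` {a} | a. a \<in> elts S}"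
  unfolding quotient_sgrp_def quotient_def by auto

lemma prd_quotient:
  assumes "a \<in> elts S" "b \<in> elts S"
  shows "prd (quotient_sgrp S cong) (cong `` {a}) (cong `` {b}) = cong `` {prd S a b}"
proof -
  have "cong `` {prd S a' b'} = cong `` {prd S a b}"
    if "(a, a') \<in> cong" "(b, b') \<in> cong" for a' b'
    using equiv_class_eq[OF equiv_congruence_gen congruence_gen_prd[OF that]] by simp
  then have "(\<Union>a'\<in>cong `` {a}. \<Union>b'\<in>cong `` {b}. cong `` {prd S a' b'})
      = (\<Union>a'\<in>cong `` {a}. \<Union>b'\<in>cong `` {b}. cong `` {prd S a b})"
    by simp
  moreover have "a \<in> cong `` {a}" "b \<in> cong `` {b}"
    using assms by (auto intro: congruence_gen.refl)
  ultimately show ?thesis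
    unfolding quotient_sgrp_def by auto
qed

lemma semigroup_record_quotient: "semigroup_record (quotient_sgrp S cong)"
proof
  let ?Q = "quotient_sgrp S cong"
  show "prd ?Q A B \<in> elts ?Q" if "A \<in> elts ?Q" "B \<in> elts ?Q" for A B
  proof -
    obtain a b where "A = cong `` {a}" "B = cong `` {b}" "a \<in> elts S" "b \<in> elts S"
      using \<open>A \<in> elts ?Q\<close> \<open>B \<in> elts ?Q\<close> unfolding elts_quotient by blast
    then show ?thesis
      using prd_closed[of a b] by (auto simp: elts_quotient prd_quotient)
  qed
  show "prd ?Q (prd ?Q A B) D = prd ?Q A (prd ?Q B D)"
    if ABD: "A \<in> elts ?Q" "B \<in> elts ?Q" "D \<in> elts ?Q" for A B D
  proof -
    obtain a b d where "A = cong `` {a}" "B = cong `` {b}" "D = cong `` {d}"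
      "a \<in> elts S" "b \<in> elts S" "d \<in> elts S"
      using ABD unfolding elts_quotient by blast
    then show ?thesis
      by (simp add: prd_quotient prd_closed prd_assoc)
  qed
qed

end

lemma semigroup_record_free: "semigroup_record (free_sgrp_with_zero X)"
  by standard (auto simp: free_sgrp_with_zero_def)

section \<open>Words acting on paths\<close>

text \<open>Generators act on all pairs of a vertex and an edge list, directed path or not: an edge is
  prepended, a ghost edge removes the first edge.  The vertex tests for \<open>Edge\<close> and \<open>Ghost\<close> make the
  relations hold at every pair, so that invariance under the congruence needs no side condition
  on paths.\<close>

fun gen_act :: "('v, 'e) pre_digraph \<Rightarrow> ('v, 'e) gen \<Rightarrow> ('v, 'e) dpath \<Rightarrow> ('v, 'e) dpath option"
where
  "gen_act G (Vert v) (u, es) = (if u = v then Some (u, es) else None)"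
| "gen_act G (Edge e) (u, es) = (if u = head G e then Some (tail G e, e # es) else None)"
| "gen_act G (Ghost e) (u, []) = None"
| "gen_act G (Ghost e) (u, f # fs) = (if f = e \<and> u = tail G e then Some (head G e, fs) else None)"

fun word_act :: "('v, 'e) pre_digraph \<Rightarrow> ('v, 'e) gen list \<Rightarrow> ('v, 'e) dpath \<Rightarrow> ('v, 'e) dpath option"
where
  "word_act G [] = Some"
| "word_act G (x # w) = gen_act G x \<circ>\<^sub>m word_act G w"

fun elt_act :: "('v, 'e) pre_digraph \<Rightarrow> ('v, 'e) gen list option \<Rightarrow> ('v, 'e) dpath \<Rightarrow> ('v, 'e) dpath option"
where
  "elt_act G None = Map.empty"
| "elt_act G (Some w) = word_act G w"

lemma word_act_append: "word_act G (v @ w) = word_act G v \<circ>\<^sub>m word_act G w"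
  by (induction v) (auto simp: map_comp_def fun_eq_iff split: option.split)

lemma elt_act_word_prd: "elt_act G (word_prd a b) = elt_act G a \<circ>\<^sub>m elt_act G b"
  by (cases "(a, b)" rule: word_prd.cases)
    (auto simp: word_act_append map_comp_def fun_eq_iff split: option.split)

lemma elt_act_relations:
  assumes "(a, b) \<in> gis_relations G"
  shows "elt_act G a = elt_act G b"
proof -
  have "elt_act G a (u, es) = elt_act G b (u, es)" for u es
    using assms
  proof cases
    case (source x) then show ?thesis by (cases x; cases es) (auto simp: map_comp_def)
  next
    case (range x) then show ?thesis by (cases x; cases es) (auto simp: map_comp_def)
  qed (auto simp: map_comp_def)
  then show ?thesis by (auto simp: fun_eq_iff)
qed

lemma elt_act_cong:
  assumes "(a, b) \<in> gis_cong G"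
  shows "elt_act G a = elt_act G b"
  using assms unfolding gis_cong_def
proof induction
  case (left a b c) then show ?case by (simp add: free_sgrp_with_zero_def elt_act_word_prd)
next
  case (right a b c) then show ?case by (simp add: free_sgrp_with_zero_def elt_act_word_prd)
qed (auto intro: elt_act_relations)

text \<open>Generators only touch the beginning of a path.\<close>

lemma word_act_append_path:
  "word_act G w (u, es) = Some (v, fs) \<Longrightarrow> word_act G w (u, es @ zs) = Some (v, fs @ zs)"
proof (induction w arbitrary: v fs)
  case (Cons x w)
  then obtain v' fs' where "word_act G w (u, es) = Some (v', fs')"
      and *: "gen_act G x (v', fs') = Some (v, fs)"
    by (auto simp: map_comp_def split: option.splits)
  with Cons.IH have "word_act G w (u, es @ zs) = Some (v', fs' @ zs)" by blast
  moreover have "gen_act G x (v', fs' @ zs) = Some (v, fs @ zs)"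
    using * by (cases x; cases fs') (auto split: if_splits)
  ultimately show ?case by (simp add: map_comp_def)
qed simp

text \<open>The representative is irrelevant by \<open>elt_act_cong\<close>.\<close>

definition class_act ::
  "('v, 'e) pre_digraph \<Rightarrow> ('v, 'e) gen list option set \<Rightarrow> ('v, 'e) dpath \<Rightarrow> ('v, 'e) dpath option"
where
  "class_act G A = elt_act G (SOME a. a \<in> A)"

abbreviation free_gis :: "('v, 'e) pre_digraph \<Rightarrow> ('v, 'e) gen list option sgrp" where
  "free_gis G \<equiv> free_sgrp_with_zero (gens G)"

interpretation free_gis: semigroup_congruence "free_gis G" "gis_relations G" for G
  by (simp add: semigroup_congruence_def semigroup_record_free)

interpretation gis: semigroup_record "gis G" for G
  unfolding gis_def gis_cong_def by (rule free_gis.semigroup_record_quotient)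

lemma word_in_free_gis: "Some w \<in> elts (free_gis G) \<longleftrightarrow> w \<noteq> [] \<and> set w \<subseteq> gens G"
  by (auto simp: free_sgrp_with_zero_def)

lemma elts_gis: "elts (gis G) = {gis_cong G `` {a} | a. a \<in> elts (free_gis G)}"
  unfolding gis_def gis_cong_def by (rule free_gis.elts_quotient)

lemma gis_class_in_gis: "w \<noteq> [] \<Longrightarrow> set w \<subseteq> gens G \<Longrightarrow> gis_class G w \<in> elts (gis G)"
  unfolding gis_class_def using word_in_free_gis[of w G] by (auto simp: elts_gis)

lemma prd_gis_class:
  assumes "v \<noteq> []" "set v \<subseteq> gens G" "w \<noteq> []" "set w \<subseteq> gens G"
  shows "prd (gis G) (gis_class G v) (gis_class G w) = gis_class G (v @ w)"
  using free_gis.prd_quotient[of "Some v" G "Some w"] assms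
  unfolding word_in_free_gis gis_class_def gis_def gis_cong_def
  by (simp add: free_sgrp_with_zero_def)

lemma class_act_class:
  assumes "a \<in> elts (free_gis G)"
  shows "class_act G (gis_cong G `` {a}) = elt_act G a"
proof -
  have "a \<in> gis_cong G `` {a}"
    using assms by (auto simp: gis_cong_def intro: congruence_gen.refl)
  then have "(SOME b. b \<in> gis_cong G `` {a}) \<in> gis_cong G `` {a}"
    by (rule someI)
  then show ?thesis
    unfolding class_act_def using elt_act_cong by force
qed

lemma class_act_gis_class:
  assumes "w \<noteq> []" "set w \<subseteq> gens G"
  shows "class_act G (gis_class G w) = word_act G w"
  using class_act_class[of "Some w" G] assms by (simp add: gis_class_def word_in_free_gis)

lemma class_act_prd:
  assumes "A \<in> elts (gis G)" "B \<in> elts (gis G)"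
  shows "class_act G (prd (gis G) A B) = class_act G A \<circ>\<^sub>m class_act G B"
proof -
  obtain a b where ab: "a \<in> elts (free_gis G)" "A = gis_cong G `` {a}"
    "b \<in> elts (free_gis G)" "B = gis_cong G `` {b}"
    using assms by (auto simp: elts_gis)
  have "prd (gis G) A B = gis_cong G `` {prd (free_gis G) a b}"
    using ab free_gis.prd_quotient unfolding gis_def gis_cong_def by blast
  moreover have "prd (free_gis G) a b = word_prd a b"
    by (simp add: free_sgrp_with_zero_def)
  moreover have "prd (free_gis G) a b \<in> elts (free_gis G)"
    using ab by (auto intro: free_gis.prd_closed)
  ultimately show ?thesis
    using ab by (simp add: class_act_class elt_act_word_prd)
qed

lemma class_act_append_path:
  assumes "A \<in> elts (gis G)" "class_act G A (u, es) = Some (v, fs)"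
  shows "class_act G A (u, es @ zs) = Some (v, fs @ zs)"
proof -
  obtain a where "a \<in> elts (free_gis G)" "A = gis_cong G `` {a}"
    using assms(1) by (auto simp: elts_gis)
  with assms(2) word_act_append_path show ?thesis
    by (cases a) (auto simp: class_act_class)
qed

lemma green_L_dom:
  assumes "(A, B) \<in> green_L (gis G)"
  shows "dom (class_act G A) = dom (class_act G B)"
proof -
  have sub: "dom (class_act G A) \<subseteq> dom (class_act G B)"
    if "B \<in> elts (gis G)" "A = B \<or> (\<exists>S\<in>elts (gis G). A = prd (gis G) S B)" for A B
    using that by (auto simp: class_act_prd map_comp_Some_iff)
  show ?thesis
    using assms unfolding gis.green_L_iff by (intro subset_antisym sub) simp_all
qed

lemma green_R_ran:
  assumes "(A, B) \<in> green_R (gis G)"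
  shows "ran (class_act G A) = ran (class_act G B)"
proof -
  have sub: "ran (class_act G A) \<subseteq> ran (class_act G B)"
    if "B \<in> elts (gis G)" "A = B \<or> (\<exists>T\<in>elts (gis G). A = prd (gis G) B T)" for A B
    using that by (fastforce simp: class_act_prd map_comp_Some_iff ran_def)
  show ?thesis
    using assms unfolding gis.green_R_iff by (intro subset_antisym sub) simp_all
qed

section \<open>The elements \<open>pq\<^sup>*\<close>\<close>

context wf_digraph
begin

lemma directed_path_iff_awalk:
  "directed_path G p \<and> path_range G p = v \<longleftrightarrow> awalk (fst p) (snd p) v"
  unfolding directed_path_def path_range_def by auto

text \<open>Changing the beginning of a directed path by a generator leaves its end vertex in place, also
  when the path becomes trivial.\<close>

lemma gen_act_awalk:
  assumes "x \<in> gens G" "gen_act G x (u, es) = Some (v, fs)" "awalk u es w"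
  shows "awalk v fs w"
  using assms
  by (cases x; cases es) (auto simp: gens_def awalk_Cons_iff awalk_Nil_iff split: if_splits)

lemma word_act_awalk:
  assumes "set ws \<subseteq> gens G" "word_act G ws (u, es) = Some (v, fs)" "awalk u es w"
  shows "awalk v fs w"
  using assms
proof (induction ws arbitrary: v fs)
  case (Cons x ws)
  then show ?case
    using gen_act_awalk[of x]
    by (auto simp: map_comp_def split: option.splits)
qed simp

lemma class_act_awalk:
  assumes "A \<in> elts (gis G)" "class_act G A (u, es) = Some (v, fs)" "awalk u es w"
  shows "awalk v fs w"
proof -
  obtain a where "a \<in> elts (free_gis G)" "A = gis_cong G `` {a}"
    using assms(1) by (auto simp: elts_gis)
  with assms(2,3) word_act_awalk show ?thesis
    by (cases a) (auto simp: class_act_class word_in_free_gis)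
qed

lemma path_word_gens:
  "awalk u es v \<Longrightarrow> set (path_word (u, es)) \<subseteq> gens G"
  "awalk u es v \<Longrightarrow> set (path_star_word (u, es)) \<subseteq> gens G"
  by (cases es; auto simp: gens_def awalk_def)+

lemma path_word_nonempty: "path_word p \<noteq> []" "path_star_word p \<noteq> []"
  by (cases p rule: path_word.cases; simp)+

lemma gis_elem_eq:
  assumes "awalk u es v" "awalk u' es' v'"
  shows "gis_elem G (u, es) (u', es') = gis_class G (path_word (u, es) @ path_star_word (u', es'))"
  unfolding gis_elem_def
  by (rule prd_gis_class[OF path_word_nonempty(1) path_word_gens(1)[OF assms(1)]
        path_word_nonempty(2) path_word_gens(2)[OF assms(2)]])

lemma gis_elem_in_gis:
  assumes "awalk u es v" "awalk u' es' v'"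
  shows "gis_elem G (u, es) (u', es') \<in> elts (gis G)"
  using path_word_gens(1)[OF assms(1)] path_word_gens(2)[OF assms(2)]
  by (simp add: gis_elem_eq[OF assms] path_word_nonempty gis_class_in_gis)

lemma word_act_edges:
  "awalk u es v \<Longrightarrow> word_act G (map Edge es) (v, zs) = Some (u, es @ zs)"
  by (induction es arbitrary: u) (auto simp: awalk_Nil_iff awalk_Cons_iff map_comp_def)

lemma word_act_edges_source:
  "word_act G (map Edge es) (w, zs) = Some k \<Longrightarrow> awalk u es v \<Longrightarrow> es \<noteq> [] \<Longrightarrow> w = v"
proof (induction es arbitrary: u k)
  case (Cons e es)
  then show ?case
    by (cases "es = []")
      (auto simp: awalk_Cons_iff awalk_Nil_iff map_comp_def split: option.splits if_splits)
qed simp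

lemma word_act_path_word:
  assumes "awalk u es v"
  shows "word_act G (path_word (u, es)) (w, zs) = (if w = v then Some (u, es @ zs) else None)"
proof (cases es)
  case Nil
  then show ?thesis using assms by (auto simp: awalk_Nil_iff map_comp_def)
next
  case (Cons e es')
  then have "path_word (u, es) = map Edge es" "es \<noteq> []" by auto
  then show ?thesis
    using word_act_edges[OF assms] word_act_edges_source[OF _ assms]
    by (metis not_Some_eq)
qed

lemma word_act_ghosts:
  "awalk u es v \<Longrightarrow> es \<noteq> [] \<Longrightarrow> word_act G (map Ghost (rev es)) (u', es') = Some (w, zs)
    \<longleftrightarrow> u' = u \<and> es' = es @ zs \<and> w = v"
proof (induction es arbitrary: u u' es')
  case (Cons e es)
  then have e: "tail G e = u" "awalk (head G e) es v" by (auto simp: awalk_Cons_iff)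
  show ?case
  proof (cases "es = []")
    case True
    with e show ?thesis
      by (cases es') (auto simp: awalk_Nil_iff map_comp_def)
  next
    case False
    with e Cons.IH[of "head G e"] show ?thesis
      by (cases es') (auto simp: word_act_append map_comp_def)
  qed
qed simp

lemma word_act_path_star_word:
  assumes "awalk u es v"
  shows "word_act G (path_star_word (u, es)) (u', es') = Some (w, zs)
    \<longleftrightarrow> u' = u \<and> es' = es @ zs \<and> w = v"
proof (cases es)
  case Nil
  then show ?thesis using assms by (auto simp: awalk_Nil_iff map_comp_def)
next
  case (Cons e es')
  then have "path_star_word (u, es) = map Ghost (rev es)" "es \<noteq> []" by auto
  then show ?thesis
    using word_act_ghosts[OF assms] by simp
qed

text \<open>\<open>q\<^sup>*\<close> strips the prefix \<open>q\<close>, leaving a pair whose vertex is \<open>r(q)\<close>; since \<open>r(q) = r(p)\<close>, the word of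
  \<open>p\<close> applies there and prepends \<open>p\<close>.\<close>

lemma class_act_gis_elem:
  assumes "awalk u es r" "awalk v fs r"
  shows "class_act G (gis_elem G (u, es) (v, fs)) k = Some l
    \<longleftrightarrow> (\<exists>zs. k = (v, fs @ zs) \<and> l = (u, es @ zs))"
proof -
  have "class_act G (gis_elem G (u, es) (v, fs)) =
    word_act G (path_word (u, es)) \<circ>\<^sub>m word_act G (path_star_word (v, fs))"
    using path_word_gens(1)[OF assms(1)] path_word_gens(2)[OF assms(2)]
    by (simp add: gis_elem_eq[OF assms] class_act_gis_class path_word_nonempty word_act_append)
  then show ?thesis
    using word_act_path_star_word[OF assms(2)] word_act_path_word[OF assms(1)]
    by (cases k; cases l) (auto simp: map_comp_Some_iff)
qed

lemma dom_class_act_gis_elem: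
  assumes "awalk u es r" "awalk v fs r"
  shows "dom (class_act G (gis_elem G (u, es) (v, fs))) = range (\<lambda>zs. (v, fs @ zs))"
  unfolding dom_def by (auto simp: class_act_gis_elem[OF assms])

lemma ran_class_act_gis_elem:
  assumes "awalk u es r" "awalk v fs r"
  shows "ran (class_act G (gis_elem G (u, es) (v, fs))) = range (\<lambda>zs. (u, es @ zs))"
  unfolding ran_def by (auto simp: class_act_gis_elem[OF assms])

text \<open>Each of the two root paths must be a prefix of the other.\<close>

lemma extensions_eq_iff:
  "range (\<lambda>zs. (v, fs @ zs)) = range (\<lambda>zs. (v', fs' @ zs)) \<longleftrightarrow> v = v' \<and> fs = fs'"
proof
  assume *: "range (\<lambda>zs. (v, fs @ zs)) = range (\<lambda>zs. (v', fs' @ zs))"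
  have "(v, fs @ []) \<in> range (\<lambda>zs. (v, fs @ zs))" "(v', fs' @ []) \<in> range (\<lambda>zs. (v', fs' @ zs))"
    by (rule rangeI)+
  then have "(v, fs) \<in> range (\<lambda>zs. (v', fs' @ zs))" "(v', fs') \<in> range (\<lambda>zs. (v, fs @ zs))"
    unfolding * by simp_all
  then obtain zs zs' where "v = v'" "fs = fs' @ zs" "fs' = fs @ zs'"
    by blast
  then show "v = v' \<and> fs = fs'" by auto
qed simp

section \<open>Products of the elements \<open>pq\<^sup>*\<close>\<close>

lemma cong_context:
  assumes "(Some w, Some w') \<in> gis_cong G" "set u \<subseteq> gens G" "set v \<subseteq> gens G"
  shows "(Some (u @ w @ v), Some (u @ w' @ v)) \<in> gis_cong G"
proof -
  have "(Some (u @ w), Some (u @ w')) \<in> gis_cong G"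
    using congruence_gen.left[OF assms(1)[unfolded gis_cong_def], of "Some u"] assms
    by (cases "u = []") (auto simp: free_sgrp_with_zero_def gis_cong_def)
  then show ?thesis
    using congruence_gen.right[of "Some (u @ w)" "Some (u @ w')" "free_gis G" "gis_relations G" "Some v"] assms(3)
    by (cases "v = []") (auto simp: free_sgrp_with_zero_def gis_cong_def)
qed

lemmas cong_trans[trans] = congruence_gen.trans[of _ _ "free_gis G" "gis_relations G",
    folded gis_cong_def]

lemma cong_refl: "w \<noteq> [] \<Longrightarrow> set w \<subseteq> gens G \<Longrightarrow> (Some w, Some w) \<in> gis_cong G"
  unfolding gis_cong_def by (rule congruence_gen.refl) (simp add: word_in_free_gis)

lemma cong_sym: "(a, b) \<in> gis_cong G \<Longrightarrow> (b, a) \<in> gis_cong G"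
  unfolding gis_cong_def by (rule congruence_gen.sym)

lemma cong_relation:
  assumes "(Some w, Some w') \<in> gis_relations G"
    "w \<noteq> []" "set w \<subseteq> gens G" "w' \<noteq> []" "set w' \<subseteq> gens G"
  shows "(Some w, Some w') \<in> gis_cong G"
  unfolding gis_cong_def using assms by (intro congruence_gen.base) (auto simp: word_in_free_gis)

text \<open>The words of paths are case distinctions on triviality.  Up to congruence both cases have the
  common form \<open>u e\<^sub>1 \<dots> e\<^sub>n\<close>, and dually for \<open>p\<^sup>*\<close>, with the source vertex always written out; this form is
  stable under appending edges and suits induction.\<close>

lemma cong_path_word:
  assumes "awalk u es v"
  shows "(Some (path_word (u, es)), Some (Vert u # map Edge es)) \<in> gis_cong G"
proof (cases es)
  case Nil
  with path_word_gens(1)[OF assms] show ?thesis by (auto intro: cong_refl)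
next
  case (Cons e es')
  with assms have e: "e \<in> arcs G" "tail G e = u" "set es' \<subseteq> arcs G" by (auto simp: awalk_def)
  then have "(Some [Vert u, Edge e], Some [Edge e]) \<in> gis_cong G"
    using gis_relations.source[of "Edge e" G] by (auto intro!: cong_relation simp: gens_def)
  from cong_context[OF cong_sym[OF this], of "[]" "map Edge es'"] e show ?thesis
    by (auto simp: Cons gens_def)
qed

lemma cong_path_star_word:
  assumes "awalk u es v"
  shows "(Some (path_star_word (u, es)), Some (map Ghost (rev es) @ [Vert u])) \<in> gis_cong G"
proof (cases es)
  case Nil
  with path_word_gens(1)[OF assms] show ?thesis by (auto intro: cong_refl)
next
  case (Cons e es')
  with assms have e: "e \<in> arcs G" "tail G e = u" "set es' \<subseteq> arcs G" by (auto simp: awalk_def)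
  then have "(Some [Ghost e, Vert u], Some [Ghost e]) \<in> gis_cong G"
    using gis_relations.range[of "Ghost e" G] by (auto intro!: cong_relation simp: gens_def)
  from cong_context[OF cong_sym[OF this], of "map Ghost (rev es')" "[]"] e show ?thesis
    by (auto simp: Cons gens_def)
qed

lemma cong_star_word_range:
  assumes "awalk u es v"
  shows "(Some (Vert v # map Ghost (rev es) @ [Vert u]), Some (map Ghost (rev es) @ [Vert u]))
    \<in> gis_cong G"
proof (cases es rule: rev_cases)
  case Nil
  with assms show ?thesis
    by (auto intro!: cong_relation gis_relations.vert_eq simp: awalk_Nil_iff gens_def)
next
  case (snoc es' e)
  with assms have e: "e \<in> arcs G" "head G e = v" "set es' \<subseteq> arcs G" "u \<in> verts G"
    by (auto simp: awalk_Cons_iff awalk_Nil_iff)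
  then have "(Some [Vert v, Ghost e], Some [Ghost e]) \<in> gis_cong G"
    using gis_relations.source[of "Ghost e" G] by (auto intro!: cong_relation simp: gens_def)
  from cong_context[OF this, of "[]" "map Ghost (rev es') @ [Vert u]"] e show ?thesis
    by (auto simp: snoc gens_def)
qed

text \<open>This is \<open>p\<^sup>*p = r(p)\<close>: the innermost pair \<open>e\<^sup>*e\<close> collapses to \<open>r(e)\<close>, which is the source of the
  rest of the path.  Doubling that vertex restores the shape of the statement.\<close>

lemma cong_star_word_word:
  assumes "awalk u es v"
  shows "(Some (map Ghost (rev es) @ [Vert u, Vert u] @ map Edge es), Some [Vert v]) \<in> gis_cong G"
  using assms
proof (induction es arbitrary: u)
  case Nil
  then show ?case
    by (auto intro!: cong_relation gis_relations.vert_eq simp: awalk_Nil_iff gens_def)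
next
  case (Cons e es)
  then have e: "e \<in> arcs G" "tail G e = u" "head G e \<in> verts G" "u \<in> verts G"
      and es: "awalk (head G e) es v"
    by (auto simp: awalk_Cons_iff)
  have sub: "set (map Ghost (rev es)) \<subseteq> gens G" "set (map Edge es) \<subseteq> gens G"
    using es by (auto simp: gens_def awalk_def)
  note ctx = cong_context[OF _ sub]
  have g: "Ghost e \<in> gens G" "Edge e \<in> gens G" "Vert u \<in> gens G" "Vert (head G e) \<in> gens G"
    using e by (auto simp: gens_def)
  have "(Some [Vert u, Edge e], Some [Edge e]) \<in> gis_cong G"
    using gis_relations.source[of "Edge e" G] g e by (auto intro!: cong_relation)
  from cong_context[OF this, of "[Ghost e, Vert u]" "[]"] g
  have "(Some [Ghost e, Vert u, Vert u, Edge e], Some [Ghost e, Vert u, Edge e]) \<in> gis_cong G"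
    by simp
  also have "(Some [Ghost e, Vert u, Edge e], Some [Ghost e, Edge e]) \<in> gis_cong G"
    using cong_context[OF \<open>(Some [Vert u, Edge e], Some [Edge e]) \<in> gis_cong G\<close>, of "[Ghost e]" "[]"] g
    by simp
  also have "(Some [Ghost e, Edge e], Some [Vert (head G e)]) \<in> gis_cong G"
    using e g by (auto intro!: cong_relation gis_relations.ghost_eq)
  also have "(Some [Vert (head G e)], Some [Vert (head G e), Vert (head G e)]) \<in> gis_cong G"
    using e g by (auto intro!: cong_sym[OF cong_relation] gis_relations.vert_eq)
  finally have "(Some (map Ghost (rev es) @ [Ghost e, Vert u, Vert u, Edge e] @ map Edge es),
      Some (map Ghost (rev es) @ [Vert (head G e), Vert (head G e)] @ map Edge es)) \<in> gis_cong G"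
    by (rule ctx)
  also note Cons.IH[OF es]
  finally show ?case by simp
qed

lemma gis_class_context:
  assumes "(Some w, Some w') \<in> gis_cong G" "set u \<subseteq> gens G" "set v \<subseteq> gens G"
  shows "gis_class G (u @ w @ v) = gis_class G (u @ w' @ v)"
  using equiv_class_eq[OF free_gis.equiv_congruence_gen] cong_context[OF assms]
  unfolding gis_class_def gis_cong_def by blast

text \<open>The reason is \<open>(pz)\<^sup>*p q\<^sup>* = z\<^sup>*p\<^sup>*p q\<^sup>* = z\<^sup>*q\<^sup>* = (qz)\<^sup>*\<close>.\<close>

lemma gis_elem_mult:
  assumes a: "awalk a as w" and p: "awalk u ps r" and q: "awalk v qs r" and z: "awalk r zs w"
  shows "prd (gis G) (gis_elem G (a, as) (u, ps @ zs)) (gis_elem G (u, ps) (v, qs))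
    = gis_elem G (a, as) (v, qs @ zs)"
proof -
  let ?gh = "\<lambda>es u. map Ghost (rev es) @ [Vert u]"
  have pz: "awalk u (ps @ zs) w" and qz: "awalk v (qs @ zs) w"
    using p q z by (auto intro: awalk_appendI simp del: awalk_append_iff)
  note wa = path_word_gens(1)[OF a] and wp = path_word_gens[OF p] and wq = path_word_gens[OF q]
    and wpz = path_word_gens[OF pz] and wqz = path_word_gens[OF qz]
  have gz: "set (map Ghost (rev zs)) \<subseteq> gens G" "set (map Ghost (rev ps)) \<subseteq> gens G"
    "set (map Ghost (rev qs)) \<subseteq> gens G" "set (map Edge ps) \<subseteq> gens G"
    "Vert u \<in> gens G" "Vert v \<in> gens G"
    using z p q by (auto simp: gens_def awalk_def)
  let ?a = "path_word (a, as)"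
  have "prd (gis G) (gis_elem G (a, as) (u, ps @ zs)) (gis_elem G (u, ps) (v, qs))
    = gis_class G (?a @ path_star_word (u, ps @ zs) @ path_word (u, ps) @ path_star_word (v, qs))"
    using wa wp wq wpz
    by (simp add: gis_elem_eq[OF a pz] gis_elem_eq[OF p q] prd_gis_class path_word_nonempty)
  also have "\<dots> = gis_class G (?a @ ?gh (ps @ zs) u @ path_word (u, ps) @ path_star_word (v, qs))"
    using wa wp wq by (intro gis_class_context[OF cong_path_star_word[OF pz]]) auto
  also have "\<dots> = gis_class G (?a @ ?gh (ps @ zs) u @ (Vert u # map Edge ps) @ path_star_word (v, qs))"
    using gis_class_context[OF cong_path_word[OF p], of "?a @ ?gh (ps @ zs) u" "path_star_word (v, qs)"]
      wa wq gz by simp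
  also have "\<dots> = gis_class G (?a @ ?gh (ps @ zs) u @ (Vert u # map Edge ps) @ ?gh qs v)"
    using gis_class_context[OF cong_path_star_word[OF q],
        of "?a @ ?gh (ps @ zs) u @ (Vert u # map Edge ps)" "[]"] wa gz by simp
  also have "\<dots> = gis_class G (?a @ map Ghost (rev zs) @ [Vert r] @ ?gh qs v)"
    using gis_class_context[OF cong_star_word_word[OF p],
        of "?a @ map Ghost (rev zs)" "?gh qs v"] wa gz by simp
  also have "\<dots> = gis_class G (?a @ map Ghost (rev zs) @ ?gh qs v)"
    using gis_class_context[OF cong_star_word_range[OF q],
        of "?a @ map Ghost (rev zs)" "[]"] wa gz by simp
  also have "\<dots> = gis_class G (?a @ path_star_word (v, qs @ zs))"
    using gis_class_context[OF cong_path_star_word[OF qz], of "?a" "[]"] wa by simp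
  also have "\<dots> = gis_elem G (a, as) (v, qs @ zs)"
    by (simp add: gis_elem_eq[OF a qz])
  finally show ?thesis .
qed

section \<open>Green's relations on the elements \<open>pq\<^sup>*\<close>\<close>

lemma green_L_gis_elem:
  assumes p: "awalk u ps r" and q: "awalk v qs r" and x: "awalk a xs t" and y: "awalk b ys t"
  shows "(gis_elem G (u, ps) (v, qs), gis_elem G (a, xs) (b, ys)) \<in> green_L (gis G)
    \<longleftrightarrow> (v, qs) = (b, ys)"
proof
  assume "(gis_elem G (u, ps) (v, qs), gis_elem G (a, xs) (b, ys)) \<in> green_L (gis G)"
  from green_L_dom[OF this] show "(v, qs) = (b, ys)"
    by (simp add: dom_class_act_gis_elem[OF p q] dom_class_act_gis_elem[OF x y] extensions_eq_iff)
next
  assume eq: "(v, qs) = (b, ys)"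
  have "r = t" using q y eq by auto
  then have r: "awalk a xs r" "awalk t [] t" "awalk r [] r"
    using x by (auto simp: awalk_Nil_iff)
  show "(gis_elem G (u, ps) (v, qs), gis_elem G (a, xs) (b, ys)) \<in> green_L (gis G)"
    unfolding gis.green_L_iff
    using gis_elem_mult[OF p r(1) q r(3)] gis_elem_mult[OF r(1) p q r(3)] eq
      gis_elem_in_gis[OF p q] gis_elem_in_gis[OF x y]
      gis_elem_in_gis[OF p r(1)] gis_elem_in_gis[OF r(1) p]
    by (metis append_Nil2 prod.inject)
qed

lemma green_R_gis_elem:
  assumes p: "awalk u ps r" and q: "awalk v qs r" and x: "awalk a xs t" and y: "awalk b ys t"
  shows "(gis_elem G (u, ps) (v, qs), gis_elem G (a, xs) (b, ys)) \<in> green_R (gis G)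
    \<longleftrightarrow> (u, ps) = (a, xs)"
proof
  assume "(gis_elem G (u, ps) (v, qs), gis_elem G (a, xs) (b, ys)) \<in> green_R (gis G)"
  from green_R_ran[OF this] show "(u, ps) = (a, xs)"
    by (simp add: ran_class_act_gis_elem[OF p q] ran_class_act_gis_elem[OF x y] extensions_eq_iff)
next
  assume eq: "(u, ps) = (a, xs)"
  have "r = t" using p x eq by auto
  then have r: "awalk b ys r" "awalk r [] r"
    using y by (auto simp: awalk_Nil_iff)
  show "(gis_elem G (u, ps) (v, qs), gis_elem G (a, xs) (b, ys)) \<in> green_R (gis G)"
    unfolding gis.green_R_iff
    using gis_elem_mult[OF p r(1) q r(2)] gis_elem_mult[OF p q r(1) r(2)] eq
      gis_elem_in_gis[OF p q] gis_elem_in_gis[OF x y]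
      gis_elem_in_gis[OF q r(1)] gis_elem_in_gis[OF r(1) q]
    by (metis append_Nil2 prod.inject)
qed

text \<open>For the converse, \<open>xq\<^sup>*\<close> is L-related to \<open>pq\<^sup>*\<close> and R-related to \<open>xy\<^sup>*\<close>.\<close>

lemma green_D_gis_elem:
  assumes p: "awalk u ps r" and q: "awalk v qs r" and x: "awalk a xs t" and y: "awalk b ys t"
  shows "(gis_elem G (u, ps) (v, qs), gis_elem G (a, xs) (b, ys)) \<in> green_D (gis G) \<longleftrightarrow> r = t"
proof
  assume "(gis_elem G (u, ps) (v, qs), gis_elem G (a, xs) (b, ys)) \<in> green_D (gis G)"
  then obtain C where L: "(gis_elem G (u, ps) (v, qs), C) \<in> green_L (gis G)"
      and R: "(C, gis_elem G (a, xs) (b, ys)) \<in> green_R (gis G)"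
    unfolding green_D_def by blast
  have C: "C \<in> elts (gis G)" using L unfolding gis.green_L_iff by blast
  have dom: "dom (class_act G C) = range (\<lambda>zs. (v, qs @ zs))"
    using green_L_dom[OF L] by (simp add: dom_class_act_gis_elem[OF p q])
  have ran: "ran (class_act G C) = range (\<lambda>zs. (a, xs @ zs))"
    using green_R_ran[OF R] by (simp add: ran_class_act_gis_elem[OF x y])
  have "(v, qs @ []) \<in> dom (class_act G C)"
    unfolding dom by (rule rangeI)
  then obtain l where l: "class_act G C (v, qs) = Some l" by auto
  then have "l \<in> ran (class_act G C)" by (rule ranI)
  then obtain zs where zs: "class_act G C (v, qs) = Some (a, xs @ zs)"
    using l unfolding ran by blast
  have "(a, xs @ []) \<in> ran (class_act G C)"
    unfolding ran by (rule rangeI)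
  then obtain k where k: "class_act G C k = Some (a, xs)"
    by (auto simp: ran_def)
  then have "k \<in> dom (class_act G C)" by auto
  then obtain zs' where "k = (v, qs @ zs')" unfolding dom by blast
  \<comment> \<open>\<open>C\<close> sends \<open>q\<close> to \<open>xz\<close> and some \<open>qz'\<close> to \<open>x\<close>; then \<open>x = xzz'\<close>, so \<open>z\<close> is trivial.\<close>
  with k class_act_append_path[OF C zs, of zs'] have "zs = []" by simp
  with class_act_awalk[OF C zs q] x show "r = t" by auto
next
  assume "r = t"
  then show "(gis_elem G (u, ps) (v, qs), gis_elem G (a, xs) (b, ys)) \<in> green_D (gis G)"
    unfolding green_D_def
    using green_L_gis_elem[OF p q _ q, of a xs] green_R_gis_elem[OF _ q x y, of a xs] x by blast
qed

text \<open>If \<open>pq\<^sup>* = S xy\<^sup>* T\<close> with \<open>S\<close> or \<open>T\<close> possibly absent, the map of \<open>T\<close> sends \<open>q\<close> into the domain of \<open>xy\<^sup>*\<close>,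
  to some \<open>yz\<close>, and keeps the end vertex \<open>r\<close>.\<close>

lemma green_J_gis_elem_imp_awalk:
  assumes p: "awalk u ps r" and q: "awalk v qs r" and x: "awalk a xs t" and y: "awalk b ys t"
    and J: "(gis_elem G (u, ps) (v, qs), gis_elem G (a, xs) (b, ys)) \<in> green_J (gis G)"
  shows "\<exists>zs. awalk t zs r"
proof -
  let ?A = "gis_elem G (u, ps) (v, qs)" and ?B = "gis_elem G (a, xs) (b, ys)"
  note B = gis_elem_in_gis[OF x y]
  obtain C where C: "C = ?B \<or> (\<exists>s\<in>elts (gis G). C = prd (gis G) s ?B)"
      and A: "?A = C \<or> (\<exists>t\<in>elts (gis G). ?A = prd (gis G) C t)"
    using gis.green_J_D[OF J] by blast
  have "C \<in> elts (gis G)" using B C gis.prd_closed by auto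
  have "class_act G ?A (v, qs) \<noteq> None"
    using class_act_gis_elem[OF p q, of "(v, qs)" "(u, ps)"] by auto
  then obtain w fs where k: "awalk w fs r" "class_act G C (w, fs) \<noteq> None"
  proof (cases "?A = C")
    case True
    then show ?thesis using that q \<open>class_act G ?A (v, qs) \<noteq> None\<close> by auto
  next
    case False
    then obtain T where T: "T \<in> elts (gis G)" "?A = prd (gis G) C T" using A by auto
    then have "class_act G ?A = class_act G C \<circ>\<^sub>m class_act G T"
      using class_act_prd \<open>C \<in> elts (gis G)\<close> by simp
    with \<open>class_act G ?A (v, qs) \<noteq> None\<close> obtain w fs where
      "class_act G T (v, qs) = Some (w, fs)" "class_act G C (w, fs) \<noteq> None"
      by (auto simp: map_comp_Some_iff)
    with class_act_awalk[OF T(1) _ q] that show ?thesis by blast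
  qed
  have "class_act G ?B (w, fs) \<noteq> None"
    using C k(2) B by (auto simp: class_act_prd map_comp_Some_iff)
  then obtain zs where "w = b" "fs = ys @ zs"
    using class_act_gis_elem[OF x y, of "(w, fs)"] by auto
  with k(1) y have "awalk t zs r" by auto
  then show ?thesis ..
qed

text \<open>\<open>xy\<^sup>* = x(pz)\<^sup>* \<cdot> pq\<^sup>* \<cdot> (qz)y\<^sup>*\<close>.\<close>

lemma gis_elem_factor:
  assumes p: "awalk u ps r" and q: "awalk v qs r" and x: "awalk a xs t" and y: "awalk b ys t"
    and z: "awalk r zs t"
  shows "\<exists>s\<in>elts (gis G). \<exists>s'\<in>elts (gis G).
    gis_elem G (a, xs) (b, ys) = prd (gis G) (prd (gis G) s (gis_elem G (u, ps) (v, qs))) s'"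
proof -
  have pz: "awalk u (ps @ zs) t" and qz: "awalk v (qs @ zs) t"
    using p q z by (auto intro: awalk_appendI simp del: awalk_append_iff)
  have "awalk t [] t" using y by (auto simp: awalk_Nil_iff)
  from gis_elem_mult[OF x p q z] gis_elem_mult[OF x qz y this]
  have "gis_elem G (a, xs) (b, ys) = prd (gis G) (prd (gis G) (gis_elem G (a, xs) (u, ps @ zs))
      (gis_elem G (u, ps) (v, qs))) (gis_elem G (v, qs @ zs) (b, ys))"
    by simp
  then show ?thesis
    using gis_elem_in_gis[OF x pz] gis_elem_in_gis[OF qz y] by blast
qed

lemma green_J_gis_elem:
  assumes p: "awalk u ps r" and q: "awalk v qs r" and x: "awalk a xs t" and y: "awalk b ys t"
  shows "(gis_elem G (u, ps) (v, qs), gis_elem G (a, xs) (b, ys)) \<in> green_J (gis G)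
    \<longleftrightarrow> (r, t) \<in> strong_connection G"
proof
  assume J: "(gis_elem G (u, ps) (v, qs), gis_elem G (a, xs) (b, ys)) \<in> green_J (gis G)"
  then have "(gis_elem G (a, xs) (b, ys), gis_elem G (u, ps) (v, qs)) \<in> green_J (gis G)"
    by (auto simp: green_J_def)
  from green_J_gis_elem_imp_awalk[OF p q x y J] green_J_gis_elem_imp_awalk[OF x y p q this]
  show "(r, t) \<in> strong_connection G"
    using p x unfolding strong_connection_def by auto
next
  assume "(r, t) \<in> strong_connection G"
  then obtain zs zs' where zs: "awalk r zs t" and zs': "awalk t zs' r"
    unfolding strong_connection_def by auto
  obtain s t where "s \<in> elts (gis G)" "t \<in> elts (gis G)"
    "gis_elem G (u, ps) (v, qs) = prd (gis G) (prd (gis G) s (gis_elem G (a, xs) (b, ys))) t"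
    using gis_elem_factor[OF x y p q zs'] by blast
  moreover obtain s' t' where "s' \<in> elts (gis G)" "t' \<in> elts (gis G)"
    "gis_elem G (a, xs) (b, ys) = prd (gis G) (prd (gis G) s' (gis_elem G (u, ps) (v, qs))) t'"
    using gis_elem_factor[OF p q x y zs] by blast
  ultimately show "(gis_elem G (u, ps) (v, qs), gis_elem G (a, xs) (b, ys)) \<in> green_J (gis G)"
    by (rule gis.green_J_I[OF gis_elem_in_gis[OF p q] gis_elem_in_gis[OF x y]])
qed

lemma equiv_strong_connection: "equiv (verts G) (strong_connection G)"
proof (rule equivI)
  show "refl_on (verts G) (strong_connection G)"
    unfolding refl_on_def strong_connection_def using awalk_Nil_iff by blast
  show "trans (strong_connection G)"
    unfolding trans_def strong_connection_def using awalk_appendI by blast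
qed (auto simp: strong_connection_def sym_def)

lemma same_strong_component_iff:
  "(\<exists>C \<in> strong_components G. r \<in> C \<and> t \<in> C) \<longleftrightarrow> (r, t) \<in> strong_connection G"
proof
  assume "\<exists>C \<in> strong_components G. r \<in> C \<and> t \<in> C"
  then show "(r, t) \<in> strong_connection G"
    unfolding strong_components_def
    using quotient_eq_iff[OF equiv_strong_connection] by blast
next
  assume rt: "(r, t) \<in> strong_connection G"
  then have r: "r \<in> verts G" by (simp add: strong_connection_def)
  show "\<exists>C \<in> strong_components G. r \<in> C \<and> t \<in> C"
    unfolding strong_components_def
    using rt quotientI[OF r] equiv_class_self[OF equiv_strong_connection r] by blast
qed

lemma green_relations_gis_elem:
  assumes "directed_path G p" "directed_path G q" "directed_path G x" "directed_path G y"
    and "path_range G p = path_range G q" "path_range G x = path_range G y"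
  shows "(gis_elem G p q, gis_elem G x y) \<in> green_L (gis G) \<longleftrightarrow> q = y"
    and "(gis_elem G p q, gis_elem G x y) \<in> green_R (gis G) \<longleftrightarrow> p = x"
    and "(gis_elem G p q, gis_elem G x y) \<in> green_D (gis G) \<longleftrightarrow> path_range G p = path_range G x"
    and "(gis_elem G p q, gis_elem G x y) \<in> green_J (gis G) \<longleftrightarrow>
      (path_range G p, path_range G x) \<in> strong_connection G"
proof -
  obtain u ps v qs a xs b ys where
    eq: "p = (u, ps)" "q = (v, qs)" "x = (a, xs)" "y = (b, ys)"
    by (metis surj_pair)
  have w: "awalk u ps (path_range G p)" "awalk v qs (path_range G p)"
    "awalk a xs (path_range G x)" "awalk b ys (path_range G x)"
    using assms directed_path_iff_awalk eq by (metis fst_conv snd_conv)+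
  show "(gis_elem G p q, gis_elem G x y) \<in> green_L (gis G) \<longleftrightarrow> q = y"
    using green_L_gis_elem[OF w] by (simp only: eq)
  show "(gis_elem G p q, gis_elem G x y) \<in> green_R (gis G) \<longleftrightarrow> p = x"
    using green_R_gis_elem[OF w] by (simp only: eq)
  show "(gis_elem G p q, gis_elem G x y) \<in> green_D (gis G) \<longleftrightarrow> path_range G p = path_range G x"
    using green_D_gis_elem[OF w] by (simp only: eq)
  show "(gis_elem G p q, gis_elem G x y) \<in> green_J (gis G) \<longleftrightarrow>
      (path_range G p, path_range G x) \<in> strong_connection G"
    using green_J_gis_elem[OF w] by (simp only: eq)
qed

end

theorem mainTheorem3:
  fixes G :: "('v, 'e) pre_digraph" and p q x y :: "('v, 'e) dpath"
  assumes "wf_digraph G" and "verts G \<noteq> {}"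
    and "directed_path G p" and "directed_path G q"
    and "directed_path G x" and "directed_path G y"
    and "path_range G p = path_range G q" and "path_range G x = path_range G y"
  shows "((gis_elem G p q, gis_elem G x y) \<in> green_L (gis G) \<longleftrightarrow> q = y) \<and>
    ((gis_elem G p q, gis_elem G x y) \<in> green_R (gis G) \<longleftrightarrow> p = x) \<and>
    ((gis_elem G p q, gis_elem G x y) \<in> green_D (gis G) \<longleftrightarrow> path_range G p = path_range G x) \<and>
    ((gis_elem G p q, gis_elem G x y) \<in> green_J (gis G) \<longleftrightarrow>
      (\<exists>C \<in> strong_components G. path_range G p \<in> C \<and> path_range G x \<in> C)) \<and>
    ((gis_elem G p q, gis_elem G x y) \<in> green_H (gis G) \<longleftrightarrow> gis_elem G p q = gis_elem G x y)"
proof -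
  interpret wf_digraph G by fact
  note green = green_relations_gis_elem[OF assms(3-8)]
  have "gis_elem G p q = gis_elem G x y" if "(gis_elem G p q, gis_elem G x y) \<in> green_H (gis G)"
    using that green(1,2) by (simp add: green_H_def)
  moreover have "(gis_elem G p q, gis_elem G x y) \<in> green_H (gis G)"
    if "gis_elem G p q = gis_elem G x y"
    using that green_relations_gis_elem(1,2)[OF assms(3,4,3,4,7,7)] by (simp add: green_H_def)
  ultimately show ?thesis
    using green same_strong_component_iff by blast
qed

end
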